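(* Let $\Gamma$ be a nonbipartite distance-regular graph with diameter $d\ge 3$ and eigenvalues $\theta_0>\theta_1>\cdots>\theta_d$. Let $k,a_1,b_1$ denote its valency and intersection numbers. Then the following are equivalent. (i) $\displaystyle \frac{k+\theta_d(a_1+1)}{(k+\theta_d)(1+\theta_d)}=\frac{k+\theta_1(a_1+1)}{(k+\theta_1)(1+\theta_1)}$. (ii) $\displaystyle \left(\theta_1+\frac{k}{a_1+1}\right)\left(\theta_d+\frac{k}{a_1+1}\right)=-\frac{k a_1 b_1}{(a_1+1)^2}$. (iii) $a_1\ne 0$ and every edge of $\Gamma$ is tight with respect to both $\theta_1$ and $\theta_d$. (iv) $a_1\ne 0$ and there exists an edge of $\Gamma$ which is tight with respect to both $\theta_1$ and $\theta_d$.
   Context: Graphs are finite, undirected, connected, without loops or multiple edges. For a graph $\Gamma=(X,R)$ with vertex set $X$, edge set $R$, path-length distance $\partial$ and diameter $d=\max\{\partial(x,y): x,y\in X\}$, put $\Gamma_i(x)=\{y\in X:\partial(x,y)=i\}$. $\Gamma$ is distance-regular if for all $0\le h,i,j\le d$ and all $x,y\in X$ with $\partial(x,y)=h$ the number $p^h_{ij}=|\Gamma_i(x)\cap\Gamma_j(y)|$ does not depend on $x,y$. Then $c_i=p^i_{1,i-1}$ $(1\le i\le d)$, $a_i=p^i_{1i}$ $(0\le i\le d)$, $b_i=p^i_{1,i+1}$ $(0\le i\le d-1)$, $c_0=0$, $b_d=0$, and $k=b_0$ is the valency. The eigenvalues of $\Gamma$ are the distinct eigenvalues of its adjacency matrix;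 there are exactly $d+1$ of them, all real, $\theta_0>\theta_1>\cdots>\theta_d$, with $\theta_0=k$ the trivial eigenvalue. $\Gamma$ is bipartite iff $a_i=0$ for $0\le i\le d$. The primitive idempotent $E$ of an eigenvalue $\theta$ is the matrix of the orthogonal projection of $\mathbb{R}^X$ onto the $\theta$-eigenspace of the adjacency matrix; $\hat z\in\mathbb{R}^X$ denotes the vector with $1$ in coordinate $z$ and $0$ elsewhere. Assume $a_1\neq 0$, let $\theta\ne k$ be an eigenvalue with primitive idempotent $E$, and let $xy\in R$. The edge $xy$ is tight with respect to $\theta$ if the three vectors $E\hat x$, $E\hat y$, $\sum_{z\in\Gamma_1(x)\cap\Gamma_1(y)}E\hat z$ are linearly dependent. *)

theory Defs
  imports "HOL-Analysis.Analysis"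
begin

text \<open>A graph is given by its adjacency relation \<open>R\<close> on a finite vertex type \<open>'v\<close>, i.e. the vertex
  set \<open>X\<close> is \<open>UNIV :: 'v set\<close>.\<close>

definition connected_graph :: "('v::finite \<Rightarrow> 'v \<Rightarrow> bool) \<Rightarrow> bool" where
  "connected_graph R \<longleftrightarrow> symp R \<and> irreflp R \<and> (\<forall>x y. R\<^sup>*\<^sup>* x y)"

definition gdist :: "('v::finite \<Rightarrow> 'v \<Rightarrow> bool) \<Rightarrow> 'v \<Rightarrow> 'v \<Rightarrow> nat" where
  "gdist R x y = (LEAST n. (R ^^ n) x y)"

definition diam :: "('v::finite \<Rightarrow> 'v \<Rightarrow> bool) \<Rightarrow> nat" where
  "diam R = Max {gdist R x y | x y. True}"

definition sphere_at :: "('v::finite \<Rightarrow> 'v \<Rightarrow> bool) \<Rightarrow> nat \<Rightarrow> 'v \<Rightarrow> 'v set" where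
  "sphere_at R i x = {y. gdist R x y = i}"

definition distance_regular :: "('v::finite \<Rightarrow> 'v \<Rightarrow> bool) \<Rightarrow> bool" where
  "distance_regular R \<longleftrightarrow> connected_graph R \<and>
     (\<forall>h \<le> diam R. \<forall>i \<le> diam R. \<forall>j \<le> diam R. \<exists>p. \<forall>x y. gdist R x y = h \<longrightarrow>
        card (sphere_at R i x \<inter> sphere_at R j y) = p)"

text \<open>\<open>intersection_number R h i j\<close> is $p^h_{ij}$. In a distance-regular graph the description is
  proper whenever \<open>h, i, j \<le> diam R\<close>.\<close>

definition intersection_number :: "('v::finite \<Rightarrow> 'v \<Rightarrow> bool) \<Rightarrow> nat \<Rightarrow> nat \<Rightarrow> nat \<Rightarrow> nat" where
  "intersection_number R h i j =
     (THE p. \<forall>x y. gdist R x y = h \<longrightarrow> card (sphere_at R i x \<inter> sphere_at R j y) = p)"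

definition a_num :: "('v::finite \<Rightarrow> 'v \<Rightarrow> bool) \<Rightarrow> nat \<Rightarrow> nat" where
  "a_num R i = intersection_number R i 1 i"

definition b_num :: "('v::finite \<Rightarrow> 'v \<Rightarrow> bool) \<Rightarrow> nat \<Rightarrow> nat" where
  "b_num R i = intersection_number R i 1 (Suc i)"

definition valency :: "('v::finite \<Rightarrow> 'v \<Rightarrow> bool) \<Rightarrow> nat" where
  "valency R = b_num R 0"

definition bipartite :: "('v::finite \<Rightarrow> 'v \<Rightarrow> bool) \<Rightarrow> bool" where
  "bipartite R \<longleftrightarrow> (\<exists>S. \<forall>x y. R x y \<longrightarrow> (x \<in> S \<longleftrightarrow> y \<notin> S))"

definition adj_matrix :: "('v::finite \<Rightarrow> 'v \<Rightarrow> bool) \<Rightarrow> real^'v^'v" where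
  "adj_matrix R = (\<chi> x y. if R x y then 1 else 0)"

definition eigenspace :: "real^'v^'v \<Rightarrow> real \<Rightarrow> (real^'v::finite) set" where
  "eigenspace A \<theta> = {v. A *v v = \<theta> *\<^sub>R v}"

definition eigenvalues :: "real^'v^'v::finite \<Rightarrow> real set" where
  "eigenvalues A = {\<theta>. \<exists>v. v \<noteq> 0 \<and> A *v v = \<theta> *\<^sub>R v}"

definition orth_proj :: "'a::euclidean_space set \<Rightarrow> 'a \<Rightarrow> 'a" where
  "orth_proj S v = (THE w. w \<in> S \<and> (\<forall>u\<in>S. orthogonal (v - w) u))"

definition primitive_idempotent :: "('v::finite \<Rightarrow> 'v \<Rightarrow> bool) \<Rightarrow> real \<Rightarrow> real^'v^'v" where
  "primitive_idempotent R \<theta> = matrix (orth_proj (eigenspace (adj_matrix R) \<theta>))"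

text \<open>Linear dependence of the three vectors as a family: they need not be distinct, so
  \<^const>\<open>dependent\<close> of the set of the three vectors would be wrong. The notion is only meant for an
  edge \<open>xy\<close>, an eigenvalue \<open>\<theta>\<close> other than the valency, and \<open>a_num R 1 \<noteq> 0\<close>.\<close>

definition tight_edge :: "('v::finite \<Rightarrow> 'v \<Rightarrow> bool) \<Rightarrow> real \<Rightarrow> 'v \<Rightarrow> 'v \<Rightarrow> bool" where
  "tight_edge R \<theta> x y \<longleftrightarrow>
     (let E = primitive_idempotent R \<theta> in
      \<exists>\<alpha> \<beta> \<gamma> :: real. (\<alpha>, \<beta>, \<gamma>) \<noteq> (0, 0, 0) \<and>
        \<alpha> *\<^sub>R (E *v axis x 1) + \<beta> *\<^sub>R (E *v axis y 1)
          + \<gamma> *\<^sub>R (\<Sum>z \<in> sphere_at R 1 x \<inter> sphere_at R 1 y. E *v axis z 1) = 0)"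

lemma orth_proj_unique:
  assumes S: "subspace S" and w: "w \<in> S" "\<forall>u\<in>S. orthogonal (v - w) u"
  shows "orth_proj S v = w"
  unfolding orth_proj_def
proof (rule the_equality)
  fix w' assume w': "w' \<in> S \<and> (\<forall>u\<in>S. orthogonal (v - w') u)"
  have "w' - w \<in> S" using S w w' by (simp add: subspace_diff)
  then have "(v - w) \<bullet> (w' - w) = 0" "(v - w') \<bullet> (w' - w) = 0"
    using w w' by (auto simp: orthogonal_def)
  then have "(w' - w) \<bullet> (w' - w) = 0" by (simp add: inner_diff_left)
  then show "w' = w" by simp
qed (use w in auto)

lemma orth_proj:
  assumes S: "subspace S"
  shows "orth_proj S v \<in> S \<and> (\<forall>u\<in>S. orthogonal (v - orth_proj S v) u)"
proof -
  obtain y z where yz: "y \<in> span S" "\<And>w. w \<in> span S \<Longrightarrow> orthogonal z w" "v = y + z"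
    using orthogonal_subspace_decomp_exists[of S v] by metis
  have "span S = S" using S by (simp add: span_eq_iff)
  with yz have "y \<in> S" "\<forall>u\<in>S. orthogonal (v - y) u" by auto
  with orth_proj_unique[OF S this] show ?thesis by simp
qed

lemma linear_orth_proj:
  assumes S: "subspace S"
  shows "linear (orth_proj S)"
proof (rule linearI)
  fix u v
  show "orth_proj S (u + v) = orth_proj S u + orth_proj S v"
    using orth_proj[OF S, of u] orth_proj[OF S, of v] S
    by (intro orth_proj_unique[OF S])
       (auto simp: subspace_add orthogonal_def inner_diff_left inner_add_left)
next
  fix c v
  show "orth_proj S (c *\<^sub>R v) = c *\<^sub>R orth_proj S v"
    using orth_proj[OF S, of v] S
    by (intro orth_proj_unique[OF S])
       (auto simp: subspace_scale orthogonal_def inner_diff_left)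
qed

lemma subspace_eigenspace: "subspace (eigenspace A \<theta>)"
  unfolding eigenspace_def
  by (auto simp: subspace_def matrix_vector_right_distrib scaleR_right_distrib
      matrix_vector_mult_scaleR mult.commute)

lemma primitive_idempotent_apply:
  "primitive_idempotent R \<theta> *v v = orth_proj (eigenspace (adj_matrix R) \<theta>) v"
  unfolding primitive_idempotent_def
  by (rule matrix_works) (simp add: linear_orth_proj subspace_eigenspace linear_matrix_vector_mul_eq)

lemma gdist_relpowp: "connected_graph R \<Longrightarrow> (R ^^ gdist R x y) x y"
  unfolding gdist_def connected_graph_def by (metis LeastI rtranclp_imp_relpowp)

lemma gdist_le: "(R ^^ n) x y \<Longrightarrow> gdist R x y \<le> n"
  unfolding gdist_def by (rule Least_le)

lemma gdist_le_diam: "gdist R x y \<le> diam R"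
  unfolding diam_def
proof (rule Max_ge)
  have "{gdist R x y | x y. True} = (\<lambda>(x, y). gdist R x y) ` UNIV" by auto
  then show "finite {gdist R x y | x y. True}" by simp
qed auto

lemma relpowp_symp: "symp R \<Longrightarrow> (R ^^ n) x y \<Longrightarrow> (R ^^ n) y x"
proof (induction n arbitrary: y)
  case (Suc n)
  then obtain z where "(R ^^ n) x z" "R z y" by auto
  with Suc show ?case by (metis relpowp_Suc_I2 sympD)
qed auto

lemma gdist_commute: "connected_graph R \<Longrightarrow> gdist R x y = gdist R y x"
  by (meson antisym connected_graph_def gdist_le gdist_relpowp relpowp_symp)

lemma gdist_eq_1_iff:
  assumes "connected_graph R" shows "gdist R x y = 1 \<longleftrightarrow> R x y"
proof
  assume "gdist R x y = 1"
  then show "R x y" using gdist_relpowp[OF assms, of x y] by (simp add: OO_def)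
next
  assume r: "R x y"
  then have "gdist R x y \<le> 1" by (intro gdist_le) (simp add: OO_def)
  moreover have "gdist R x y \<noteq> 0"
  proof
    assume "gdist R x y = 0"
    then have "x = y" using gdist_relpowp[OF assms, of x y] by simp
    with r assms show False by (auto simp: connected_graph_def irreflp_def)
  qed
  ultimately show "gdist R x y = 1" by simp
qed

lemma gdist_step: "connected_graph R \<Longrightarrow> R y z \<Longrightarrow> gdist R x z \<le> Suc (gdist R x y)"
  by (meson gdist_le gdist_relpowp relpowp_Suc_I)

lemma ex_gdist:
  assumes "connected_graph R" "h \<le> diam R"
  shows "\<exists>x y. gdist R x y = h"
proof -
  have "{gdist R x y | x y. True} = (\<lambda>(x, y). gdist R x y) ` UNIV" by auto
  then have fin: "finite {gdist R x y | x y. True}" by simp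
  have "diam R \<in> {gdist R x y | x y. True}"
    unfolding diam_def using fin by (intro Max_in) auto
  then obtain x y where d: "gdist R x y = diam R" by auto
  have "(R ^^ (h + (diam R - h))) x y" using gdist_relpowp[OF assms(1), of x y] d assms(2) by simp
  then obtain z where z: "(R ^^ h) x z" "(R ^^ (diam R - h)) z y"
    unfolding relpowp_add by auto
  have "gdist R x z = h"
  proof (rule antisym)
    show "gdist R x z \<le> h" using z(1) by (rule gdist_le)
    have "(R ^^ (gdist R x z + (diam R - h))) x y"
      unfolding relpowp_add using gdist_relpowp[OF assms(1), of x z] z(2) by auto
    from gdist_le[OF this] d assms(2) show "h \<le> gdist R x z" by simp
  qed
  then show ?thesis by auto
qed

lemma intersection_number_eq:
  assumes R: "distance_regular R" and le: "i \<le> diam R" "j \<le> diam R"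
  shows "card (sphere_at R i x \<inter> sphere_at R j y) = intersection_number R (gdist R x y) i j"
proof -
  obtain p where p: "\<forall>x' y'. gdist R x' y' = gdist R x y \<longrightarrow>
      card (sphere_at R i x' \<inter> sphere_at R j y') = p"
    using R le gdist_le_diam[of R x y] unfolding distance_regular_def by meson
  have "intersection_number R (gdist R x y) i j = p"
    unfolding intersection_number_def using p by (intro the_equality) auto
  then show ?thesis using p by auto
qed

lemma bipartite_iff:
  assumes R: "distance_regular R" and d: "diam R \<ge> 1"
  shows "bipartite R \<longleftrightarrow> (\<forall>i \<le> diam R. a_num R i = 0)"
proof
  have G: "connected_graph R" using R by (simp add: distance_regular_def)
  assume "bipartite R"
  then obtain S where S: "\<And>x y. R x y \<Longrightarrow> (x \<in> S \<longleftrightarrow> y \<notin> S)"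
    unfolding bipartite_def by metis
  have par: "(R ^^ n) x y \<Longrightarrow> (x \<in> S \<longleftrightarrow> y \<in> S) \<longleftrightarrow> even n" for n x y
  proof (induction n arbitrary: y)
    case (Suc n)
    then obtain z where "(R ^^ n) x z" "R z y" by auto
    with Suc.IH[of z] S[of z y] show ?case by auto
  qed auto
  show "\<forall>i \<le> diam R. a_num R i = 0"
  proof (intro allI impI)
    fix i assume i: "i \<le> diam R"
    obtain x y where xy: "gdist R x y = i" using ex_gdist[OF G i] by auto
    have "sphere_at R 1 x \<inter> sphere_at R i y = {}"
    proof (rule equals0I)
      fix z assume "z \<in> sphere_at R 1 x \<inter> sphere_at R i y"
      then have "gdist R x z = 1" "gdist R y z = gdist R x y"
        using xy by (auto simp: sphere_at_def)
      then show False
        using S[of x z] par[OF gdist_relpowp[OF G], of x y] par[OF gdist_relpowp[OF G], of y z]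
          gdist_eq_1_iff[OF G, of x z] by metis
    qed
    then show "a_num R i = 0"
      using intersection_number_eq[OF R d i, of x y] xy by (simp add: a_num_def)
  qed
next
  have G: "connected_graph R" using R by (simp add: distance_regular_def)
  assume a: "\<forall>i \<le> diam R. a_num R i = 0"
  fix x0 :: 'a
  have ne: "gdist R x0 x \<noteq> gdist R x0 y" if "R x y" for x y
  proof
    assume eq: "gdist R x0 x = gdist R x0 y"
    let ?i = "gdist R x0 x"
    have "y \<in> sphere_at R 1 x \<inter> sphere_at R ?i x0"
      using that eq gdist_eq_1_iff[OF G] by (simp add: sphere_at_def)
    moreover have "card (sphere_at R 1 x \<inter> sphere_at R ?i x0) = 0"
      using intersection_number_eq[OF R d gdist_le_diam[of R x0 x], of x x0] a
        gdist_commute[OF G, of x x0] gdist_le_diam[of R x0 x]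
      by (simp add: a_num_def)
    ultimately show False by (auto simp: card_eq_0_iff)
  qed
  have "even (gdist R x0 x) \<longleftrightarrow> odd (gdist R x0 y)" if r: "R x y" for x y
  proof -
    have "R y x" using r G by (auto simp: connected_graph_def dest: sympD)
    then have "gdist R x0 x = Suc (gdist R x0 y) \<or> gdist R x0 y = Suc (gdist R x0 x)"
      using ne[OF r] gdist_step[OF G r, of x0] gdist_step[OF G, of y x x0] by linarith
    then show ?thesis by auto
  qed
  then show "bipartite R"
    unfolding bipartite_def by (intro exI[of _ "{x. even (gdist R x0 x)}"]) simp
qed

end

theory Submission
  imports Defs
begin

text \<open>
  Fix an edge \<open>xy\<close> and an eigenvalue \<open>\<theta>\<close> with \<open>\<bar>\<theta>\<bar> < k\<close> and primitive idempotent \<open>E\<close>. Put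
  \<open>a = a\<^sub>1\<close>, \<open>b = b\<^sub>1\<close>, and let \<open>g\<close> be the number of ordered pairs of common neighbours of
  \<open>x\<close> and \<open>y\<close> that are at distance 2. Tightness is linear dependence of \<open>E x\<close>, \<open>E y\<close> and the sum
  \<open>s\<close> of \<open>E z\<close> over the common neighbours \<open>z\<close>, so it is decided by the Gram matrix of these three
  vectors. In a distance-regular graph \<open>E\<close> is a polynomial in the adjacency matrix, hence its
  entries, which are the inner products of the vectors \<open>E z\<close>, depend only on distance; the
  eigenvalue equation determines their ratios at distances 0, 1 and 2 in terms of \<open>\<theta>\<close>. As two
  neighbours of \<open>x\<close> are at distance at most 2, the Gram determinant is explicit in \<open>g\<close>, and
  up to a positive factor it equals
  \<open>a * b * (k + \<theta> * (a + 1)) - g * ((1 + \<theta>) * (k + \<theta>))\<close>. So this number is nonnegative and it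
  vanishes exactly when the edge is tight (\<open>tight_edge_bound\<close>).

  For \<open>\<theta>\<^sub>1\<close> the factor \<open>(1 + \<theta>) * (k + \<theta>)\<close> is positive, and for \<open>\<theta>\<^sub>d\<close> it is negative: nonadjacent
  vertices give a nonnegative Rayleigh quotient orthogonal to the constant vector, an induced path
  with three vertices gives a Rayleigh quotient below \<open>-1\<close>, and \<open>\<theta>\<^sub>d > -k\<close> because the graph is not
  bipartite. With
  \<open>Q \<theta> = (k + \<theta> * (a + 1)) / ((k + \<theta>) * (1 + \<theta>))\<close> the two inequalities read
  \<open>a * b * Q \<theta>\<^sub>d \<le> g \<le> a * b * Q \<theta>\<^sub>1\<close>. Condition (i) is \<open>Q \<theta>\<^sub>d = Q \<theta>\<^sub>1\<close>, which forces equality on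
  both sides for every edge; conversely, equality on both sides for a single edge gives (i), since
  \<open>a * b\<close> is not zero. If \<open>a = 0\<close> then \<open>Q \<theta> = 1 / (1 + \<theta>)\<close>, which is injective, so (i)
  fails. The equivalence of (i) and (ii) is algebra: cross-multiplying (i)
  and using \<open>k = 1 + a + b\<close> turns it into (ii) multiplied by
  \<open>\<theta>\<^sub>1 - \<theta>\<^sub>d\<close> and a power of \<open>a + 1\<close>, both nonzero.
\<close>

section \<open>Self-adjoint operators on Euclidean spaces\<close>

text \<open>The Rayleigh quotient attains its maximum on the unit sphere of \<open>S\<close> by compactness, and a
  maximiser is an eigenvector. Restricting to an invariant subspace \<open>S\<close> serves both for the spectral
  theorem (\<open>S\<close> the complement of the eigenvectors) and for the largest nontrivial eigenvalue
  (\<open>S\<close> the complement of the constant vectors).\<close>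

lemma self_adjoint_max_eigenvector:
  fixes f :: "'a::euclidean_space \<Rightarrow> 'a"
  assumes lin: "linear f" and sa: "\<And>x y. f x \<bullet> y = x \<bullet> f y"
    and S: "subspace S" "S \<noteq> {0}" and inv: "\<And>x. x \<in> S \<Longrightarrow> f x \<in> S"
  shows "\<exists>v \<mu>. v \<in> S \<and> v \<noteq> 0 \<and> f v = \<mu> *\<^sub>R v \<and> (\<forall>w\<in>S. w \<bullet> f w \<le> \<mu> * (w \<bullet> w))"
proof -
  note [simp] = linear_add[OF lin] linear_diff[OF lin] linear_scale[OF lin] linear_0[OF lin]
  let ?K = "S \<inter> sphere 0 1"
  have normalize: "w /\<^sub>R norm w \<in> ?K" if "w \<in> S" "w \<noteq> 0" for w
    using that S(1) by (simp add: subspace_scale)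
  obtain w0 where "w0 \<in> S" "w0 \<noteq> 0"
    using S subspace_0 by blast
  then have "?K \<noteq> {}" using normalize by blast
  moreover have "compact ?K"
    using closed_subspace[OF S(1)] by (simp add: closed_Int_compact)
  moreover have "continuous_on ?K (\<lambda>w. w \<bullet> f w)"
    by (intro continuous_intros linear_continuous_on linear_conv_bounded_linear[THEN iffD1] lin)
  ultimately obtain v where v: "v \<in> ?K" and max: "\<And>w. w \<in> ?K \<Longrightarrow> w \<bullet> f w \<le> v \<bullet> f v"
    using continuous_attains_sup by metis
  define \<mu> where "\<mu> = v \<bullet> f v"
  have vv: "v \<bullet> v = 1" and vS: "v \<in> S" using v by (auto simp: dot_square_norm)
  have ray: "w \<bullet> f w \<le> \<mu> * (w \<bullet> w)" if "w \<in> S" for w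
  proof (cases "w = 0")
    case False
    then show ?thesis
      using max[OF normalize[OF that False]]
      by (simp add: \<mu>_def[symmetric] divide_simps dot_square_norm power2_eq_square)
  qed simp
  \<comment> \<open>The residual \<open>r\<close> is an admissible direction of variation at the maximiser, and the first
    variation in that direction is a multiple of \<open>r \<bullet> r\<close>.\<close>
  define r where "r = f v - \<mu> *\<^sub>R v"
  have rS: "r \<in> S" using vS inv S(1) by (simp add: r_def subspace_diff subspace_scale)
  define K where "K = \<mu> * (r \<bullet> r) - r \<bullet> f r"
  have K: "K \<ge> 0" using ray[OF rS] by (simp add: K_def)
  have vary: "2 * t * (r \<bullet> r) \<le> t\<^sup>2 * K" for t
  proof -
    have "v + t *\<^sub>R r \<in> S" using vS rS S(1) by (simp add: subspace_add subspace_scale)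
    from ray[OF this]
    have "\<mu> + 2 * t * (r \<bullet> f v) + t\<^sup>2 * (r \<bullet> f r) \<le> \<mu> * (1 + 2 * t * (r \<bullet> v) + t\<^sup>2 * (r \<bullet> r))"
      using sa[of v r]
      by (simp add: inner_add_left inner_add_right vv \<mu>_def[symmetric] power2_eq_square
          inner_commute[of v r] inner_commute[of "f v" r] ring_distribs mult_ac)
    moreover have "r \<bullet> r = r \<bullet> f v - \<mu> * (r \<bullet> v)"
      by (subst (2) r_def) (simp add: inner_diff_right)
    then have "2 * t * (r \<bullet> r) = 2 * t * (r \<bullet> f v) - 2 * t * (\<mu> * (r \<bullet> v))"
      by (simp only: right_diff_distrib)
    ultimately show ?thesis unfolding K_def by (simp only: ring_distribs mult_ac)
  qed
  have "r \<bullet> r = 0"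
  proof (rule ccontr)
    assume "r \<bullet> r \<noteq> 0"
    then have c: "r \<bullet> r > 0" by simp
    \<comment> \<open>A step so small that the quadratic term \<open>t\<^sup>2 * K\<close> stays below the linear one; adding 1
      guards against \<open>K = 0\<close>.\<close>
    define t where "t = (r \<bullet> r) / (K + 1)"
    have t: "t > 0" "t * K \<le> r \<bullet> r" using c K by (auto simp: t_def divide_simps algebra_simps)
    then have "2 * (r \<bullet> r) \<le> t * K" using vary[of t] by (simp add: power2_eq_square)
    with t c show False by simp
  qed
  then have "f v = \<mu> *\<^sub>R v" by (simp add: r_def)
  moreover have "v \<noteq> 0" using vv by auto
  ultimately show ?thesis using vS ray by (intro exI conjI ballI)
qed

text \<open>The orthogonal complement of all eigenvectors is invariant, so if it were nonzero it would
  contain an eigenvector, orthogonal to itself.\<close>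

lemma self_adjoint_eigenvectors_span:
  fixes f :: "'a::euclidean_space \<Rightarrow> 'a"
  assumes lin: "linear f" and sa: "\<And>x y. f x \<bullet> y = x \<bullet> f y"
  shows "span {v. \<exists>\<mu>. f v = \<mu> *\<^sub>R v} = UNIV"
proof (rule ccontr)
  let ?W = "{v. \<exists>\<mu>. f v = \<mu> *\<^sub>R v}"
  define S where "S = {u. \<forall>v\<in>?W. u \<bullet> v = 0}"
  assume "span ?W \<noteq> UNIV"
  then obtain u where u: "u \<notin> span ?W" by auto
  obtain p q where "p \<in> span ?W" "\<And>w. w \<in> span ?W \<Longrightarrow> orthogonal q w" "u = p + q"
    using orthogonal_subspace_decomp_exists[of ?W u] by blast
  then have "q \<in> S" "q \<noteq> 0" using u unfolding S_def by (auto simp: orthogonal_def span_base)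
  then have ne: "S \<noteq> {0}" by blast
  have sub: "subspace S" by (auto simp: S_def subspace_def inner_add_left)
  have inv: "f x \<in> S" if "x \<in> S" for x
    unfolding S_def
  proof (clarify)
    fix v \<mu> assume v: "f v = \<mu> *\<^sub>R v"
    then have "x \<bullet> v = 0" using that unfolding S_def by blast
    with v show "f x \<bullet> v = 0" by (simp add: sa)
  qed
  obtain v \<mu> where "v \<in> S" "v \<noteq> 0" "f v = \<mu> *\<^sub>R v"
    using self_adjoint_max_eigenvector[OF lin sa sub ne inv] by blast
  then have "v \<bullet> v = 0" unfolding S_def by blast
  with \<open>v \<noteq> 0\<close> show False by simp
qed

section \<open>The adjacency matrix of a connected regular graph\<close>

lemma adj_matrix_mult_nth: "(adj_matrix R *v v) $ x = (\<Sum>z | R x z. v $ z)"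
  by (simp add: adj_matrix_def matrix_vector_mult_def sum.If_cases if_distrib[of "\<lambda>c. c * _"] cong: if_cong)

lemma adj_matrix_inner_axis: "axis x 1 \<bullet> (adj_matrix R *v axis y 1) = (if R x y then 1 else 0)"
  by (simp add: inner_axis' matrix_vector_mult_basis column_def adj_matrix_def)

lemma axis_one_inner: "(axis x 1 :: real^'v::finite) \<bullet> axis y 1 = (if x = y then 1 else 0)"
  by (simp add: inner_axis_axis)

lemma adj_matrix_self_adjoint:
  assumes "symp R"
  shows "(adj_matrix R *v v) \<bullet> w = v \<bullet> (adj_matrix R *v w)"
proof -
  have "transpose (adj_matrix R) = adj_matrix R"
    using assms by (auto simp: adj_matrix_def transpose_def vec_eq_iff symp_def)
  then show ?thesis by (metis dot_lmul_matrix vector_transpose_matrix)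
qed

text \<open>For \<open>c = -1\<close> and \<open>c = 1\<close> this is the quadratic form of the Laplacian and of the signless
  Laplacian: its nonnegativity bounds the spectrum by the valency on either side, and its zeros are
  read off edge by edge.\<close>

lemma sum_edges_squares:
  fixes v :: "real^'v::finite"
  assumes sym: "symp R" and reg: "\<And>x. real (card {z. R x z}) = k" and c: "c\<^sup>2 = 1"
  shows "(\<Sum>x\<in>UNIV. \<Sum>y | R x y. (v $ x + c * v $ y)\<^sup>2)
      = 2 * (k * (v \<bullet> v) + c * (v \<bullet> (adj_matrix R *v v)))"
proof -
  have "(\<Sum>x\<in>UNIV. \<Sum>y | R x y. (v $ y)\<^sup>2) = (\<Sum>y\<in>UNIV. \<Sum>x | R x y. (v $ y)\<^sup>2)"
    using sum.swap_restrict[of UNIV UNIV "\<lambda>x y. (v $ y)\<^sup>2" R] by simp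
  also have "\<dots> = k * (v \<bullet> v)"
  proof -
    have "{x. R x y} = {x. R y x}" for y using sym by (auto dest: sympD)
    then show ?thesis by (simp add: reg inner_vec_def sum_distrib_left power2_eq_square)
  qed
  finally have 1: "(\<Sum>x\<in>UNIV. \<Sum>y | R x y. (v $ y)\<^sup>2) = k * (v \<bullet> v)" .
  have 2: "(\<Sum>x\<in>UNIV. \<Sum>y | R x y. (v $ x)\<^sup>2) = k * (v \<bullet> v)"
    by (simp add: reg inner_vec_def sum_distrib_left power2_eq_square)
  have 3: "(\<Sum>x\<in>UNIV. \<Sum>y | R x y. v $ x * v $ y) = v \<bullet> (adj_matrix R *v v)"
    by (simp add: inner_vec_def adj_matrix_mult_nth sum_distrib_left)
  have "(v $ x + c * v $ y)\<^sup>2 = (v $ x)\<^sup>2 + (v $ y)\<^sup>2 + 2 * c * (v $ x * v $ y)" for x y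
    using c by (simp add: power2_sum power_mult_distrib)
  then have "(\<Sum>x\<in>UNIV. \<Sum>y | R x y. (v $ x + c * v $ y)\<^sup>2)
    = (\<Sum>x\<in>UNIV. \<Sum>y | R x y. (v $ x)\<^sup>2) + (\<Sum>x\<in>UNIV. \<Sum>y | R x y. (v $ y)\<^sup>2)
      + 2 * c * (\<Sum>x\<in>UNIV. \<Sum>y | R x y. v $ x * v $ y)"
    by (simp add: sum.distrib sum_distrib_left)
  then show ?thesis unfolding 1 2 3 by simp
qed

lemma eigenvalue_bound:
  fixes v :: "real^'v::finite"
  assumes sym: "symp R" and reg: "\<And>x. real (card {z. R x z}) = k" and c: "c\<^sup>2 = 1"
    and v: "v \<noteq> 0" "adj_matrix R *v v = \<mu> *\<^sub>R v"
  shows "0 \<le> k + c * \<mu>" and "k + c * \<mu> = 0 \<Longrightarrow> R x y \<Longrightarrow> v $ x = - c * v $ y"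
proof -
  have eq: "(\<Sum>x\<in>UNIV. \<Sum>y | R x y. (v $ x + c * v $ y)\<^sup>2) = 2 * (k + c * \<mu>) * (v \<bullet> v)"
    using sum_edges_squares[OF sym reg c, of v] v(2) by (simp add: algebra_simps)
  have "0 \<le> (\<Sum>x\<in>UNIV. \<Sum>y | R x y. (v $ x + c * v $ y)\<^sup>2)" by (intro sum_nonneg) auto
  then have "0 \<le> (k + c * \<mu>) * (v \<bullet> v)" unfolding eq by linarith
  moreover have "0 < v \<bullet> v" using v(1) by simp
  ultimately show "0 \<le> k + c * \<mu>" by (simp only: zero_le_mult_iff) linarith
  assume 0: "k + c * \<mu> = 0" and xy: "R x y"
  have "(\<Sum>x\<in>UNIV. \<Sum>y | R x y. (v $ x + c * v $ y)\<^sup>2) = 0" unfolding eq 0 by simp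
  then have "(\<Sum>y | R x y. (v $ x + c * v $ y)\<^sup>2) = 0"
    using sum_nonneg_eq_0_iff[of UNIV "\<lambda>x. \<Sum>y | R x y. (v $ x + c * v $ y)\<^sup>2"]
    by (simp add: sum_nonneg)
  then have "(v $ x + c * v $ y)\<^sup>2 = 0"
    using sum_nonneg_eq_0_iff[of "{y. R x y}" "\<lambda>y. (v $ x + c * v $ y)\<^sup>2"] xy by simp
  then show "v $ x = - c * v $ y" by simp
qed

lemma valency_eigenvector_constant:
  assumes G: "connected_graph R" and reg: "\<And>x. real (card {z. R x z}) = k"
    and v: "v \<noteq> 0" "adj_matrix R *v v = k *\<^sub>R v"
  shows "v $ x = v $ y"
proof -
  have edge: "v $ x = v $ y" if "R x y" for x y
    using eigenvalue_bound(2)[OF _ reg _ v, of "-1" x y] G that by (simp add: connected_graph_def)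
  have "R\<^sup>*\<^sup>* x y" using G by (simp add: connected_graph_def)
  then show ?thesis
  proof (induction)
    case (step y z)
    then show ?case using edge[of y z] by simp
  qed simp
qed

text \<open>An eigenvector for \<open>- k\<close> changes sign along every edge, and by connectedness it vanishes
  nowhere, so its signs are a bipartition.\<close>

lemma minus_valency_eigenvalue_imp_bipartite:
  assumes G: "connected_graph R" and reg: "\<And>x. real (card {z. R x z}) = k"
    and "- k \<in> eigenvalues (adj_matrix R)"
  shows "bipartite R"
proof -
  obtain v where v: "v \<noteq> 0" "adj_matrix R *v v = (- k) *\<^sub>R v"
    using assms(3) by (auto simp: eigenvalues_def)
  have neg: "v $ x = - v $ y" if "R x y" for x y
    using eigenvalue_bound(2)[OF _ reg _ v, of 1 x y] G that by (simp add: connected_graph_def)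
  have nz: "v $ x \<noteq> 0" for x
  proof
    assume "v $ x = 0"
    have "v $ y = 0" for y
    proof -
      have "R\<^sup>*\<^sup>* x y" using G by (simp add: connected_graph_def)
      then show ?thesis 
      proof (induction)
        case (step y z)
        then show ?case using neg[of y z] by simp
      qed (fact \<open>v $ x = 0\<close>)
    qed
    with v(1) show False by (simp add: vec_eq_iff)
  qed
  show ?thesis unfolding bipartite_def
  proof (intro exI[of _ "{x. v $ x > 0}"] allI impI)
    fix x y assume "R x y"
    then have "v $ x > 0 \<longleftrightarrow> \<not> v $ y > 0" using neg[of x y] nz[of y] by linarith
    then show "x \<in> {x. v $ x > 0} \<longleftrightarrow> y \<notin> {x. v $ x > 0}" by simp
  qed
qed

lemma valency_eigenvalue:
  fixes R :: "'v::finite \<Rightarrow> 'v \<Rightarrow> bool"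
  assumes reg: "\<And>x. real (card {z. R x z}) = k"
  shows "k \<in> eigenvalues (adj_matrix R)"
proof -
  let ?one = "(\<chi> x. 1) :: real^'v"
  have "adj_matrix R *v ?one = k *\<^sub>R ?one"
    by (simp add: vec_eq_iff adj_matrix_mult_nth reg)
  moreover have "?one \<noteq> 0" by (simp add: vec_eq_iff)
  ultimately show ?thesis unfolding eigenvalues_def by (intro CollectI exI[of _ ?one] conjI)
qed

text \<open>On an induced path with three vertices the alternating vector \<open>(1, -1, 1)\<close> has Rayleigh
  quotient \<open>-4/3\<close>.\<close>

lemma eigenvalue_lt_minus_one:
  assumes "symp R" "R x y" "R y z" "\<not> R x z" "x \<noteq> z" "irreflp R"
  shows "\<exists>\<mu> \<in> eigenvalues (adj_matrix R). \<mu> < - 1"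
proof -
  let ?A = "adj_matrix R"
  have "linear (\<lambda>v. - (?A *v v))" by (intro linear_compose_neg matrix_vector_mul_linear)
  moreover have "(- (?A *v v)) \<bullet> w = v \<bullet> (- (?A *v w))" for v w
    by (simp add: adj_matrix_self_adjoint[OF assms(1)])
  ultimately have "\<exists>v \<mu>. v \<in> UNIV \<and> v \<noteq> 0 \<and> - (?A *v v) = \<mu> *\<^sub>R v
      \<and> (\<forall>w\<in>UNIV. w \<bullet> (- (?A *v w)) \<le> \<mu> * (w \<bullet> w))"
    by (rule self_adjoint_max_eigenvector) (simp_all add: UNIV_not_singleton)
  then obtain v \<mu> where v: "v \<noteq> 0" "- (?A *v v) = \<mu> *\<^sub>R v"
    and ray: "\<And>w. w \<bullet> (- (?A *v w)) \<le> \<mu> * (w \<bullet> w)"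
    by blast
  have sym: "R y x" "R z y" "\<not> R z x" using assms by (auto dest: sympD)
  have irr: "\<not> R u u" for u using assms(6) by (simp add: irreflp_def)
  have ne: "x \<noteq> y" "y \<noteq> z" using assms irr by auto
  let ?w = "axis x 1 - axis y 1 + axis z 1 :: real^'a"
  have "?w \<bullet> (- (?A *v ?w)) = 4"
    using assms sym irr
    by (simp add: matrix_vector_right_distrib matrix_vector_mult_diff_distrib inner_add_left
        inner_diff_left inner_add_right inner_diff_right adj_matrix_inner_axis)
  moreover have "?w \<bullet> ?w = 3"
    using ne assms(5)
    by (simp add: inner_add_left inner_diff_left inner_add_right inner_diff_right axis_one_inner)
  ultimately have "\<mu> > 1" using ray[of ?w] by simp
  moreover have "- \<mu> \<in> eigenvalues ?A"
    using v by (auto simp: eigenvalues_def intro!: exI[of _ v]) (metis minus_equation_iff scaleR_minus_left)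
  ultimately show ?thesis by (intro bexI[of _ "- \<mu>"]) auto
qed

text \<open>The difference of the unit vectors of two nonadjacent vertices is orthogonal to the constants and has Rayleigh
  quotient 0; the maximum over that orthogonal complement is an eigenvalue, and it is not \<open>k\<close> because
  eigenvectors for \<open>k\<close> are constant.\<close>

lemma nontrivial_eigenvalue_nonneg:
  assumes G: "connected_graph R" and reg: "\<And>x. real (card {z. R x z}) = k"
    and xz: "x \<noteq> z" "\<not> R x z"
  shows "\<exists>\<mu> \<in> eigenvalues (adj_matrix R). \<mu> \<noteq> k \<and> \<mu> \<ge> 0"
proof -
  let ?A = "adj_matrix R"
  let ?one = "(\<chi> x. 1) :: real^'a"
  define S where "S = {w. w \<bullet> ?one = 0}"
  have sym: "symp R" and irr: "\<And>u. \<not> R u u" using G by (auto simp: connected_graph_def irreflp_def)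
  let ?w = "axis x 1 - axis z 1 :: real^'a"
  have w: "?w \<in> S" by (simp add: S_def inner_diff_left inner_axis')
  have ww: "?w \<bullet> ?w = 2"
    using xz by (simp add: inner_diff_left inner_diff_right axis_one_inner)
  have one: "?A *v ?one = k *\<^sub>R ?one" by (simp add: vec_eq_iff adj_matrix_mult_nth reg)
  have sub: "subspace S" by (auto simp: S_def subspace_def inner_add_left)
  have ne: "S \<noteq> {0}"
  proof
    assume "S = {0}"
    then have "?w = 0" using w by (simp only: singleton_iff)
    with ww show False by (simp only: inner_zero_left)
  qed
  have inv: "?A *v u \<in> S" if "u \<in> S" for u
    using that by (simp add: S_def adj_matrix_self_adjoint[OF sym] one)
  obtain v \<mu> where v: "v \<in> S" "v \<noteq> 0" "?A *v v = \<mu> *\<^sub>R v"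
    and ray: "\<And>w. w \<in> S \<Longrightarrow> w \<bullet> (?A *v w) \<le> \<mu> * (w \<bullet> w)"
    using self_adjoint_max_eigenvector[OF matrix_vector_mul_linear[of ?A]
        adj_matrix_self_adjoint[OF sym] sub ne inv] by blast
  have "\<not> R z x" using xz sympD[OF sym, of z x] by blast
  then have "?w \<bullet> (?A *v ?w) = 0"
    using xz irr
    by (simp add: matrix_vector_mult_diff_distrib inner_diff_left inner_diff_right
        adj_matrix_inner_axis)
  with ray[OF w] ww have "\<mu> \<ge> 0" by simp
  moreover have "\<mu> \<noteq> k"
  proof
    assume "\<mu> = k"
    then have c: "v $ u = v $ x" for u
      by (intro valency_eigenvector_constant[OF G reg v(2)]) (simp add: v(3))
    have "v \<bullet> ?one = (\<Sum>u\<in>UNIV. v $ u)" by (simp add: inner_vec_def)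
    also have "\<dots> = (\<Sum>u\<in>(UNIV::'a set). v $ x)" by (intro sum.cong refl c)
    also have "\<dots> = real CARD('a) * v $ x" by simp
    finally have "v \<bullet> ?one = real CARD('a) * v $ x" .
    with v(1) have "v $ x = 0" by (simp add: S_def)
    then have "v $ u = 0" for u using c[of u] by simp
    with v(2) show False by (simp add: vec_eq_iff)
  qed
  moreover have "\<mu> \<in> eigenvalues ?A"
    unfolding eigenvalues_def using v(2,3) by (intro CollectI exI[of _ v] conjI)
  ultimately show ?thesis by blast
qed

section \<open>Counting around an edge\<close>

lemma sphere_one: "connected_graph R \<Longrightarrow> sphere_at R 1 x = {z. R x z}"
  by (auto simp: sphere_at_def gdist_eq_1_iff simp del: One_nat_def)

lemma gdist_self [simp]: "gdist R x x = 0"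
  using gdist_le[of 0 R x x] by simp

lemma gdist_eq_0_iff: "connected_graph R \<Longrightarrow> gdist R x y = 0 \<longleftrightarrow> x = y"
  using gdist_relpowp[of R x y] by auto

lemma card_neighbours:
  assumes R: "distance_regular R" and d: "diam R \<ge> 1"
  shows "card {z. R x z} = valency R"
  using intersection_number_eq[OF R d d, of x x] R
  by (simp add: valency_def b_num_def distance_regular_def sphere_one[unfolded One_nat_def])

lemma card_common_neighbours:
  assumes R: "distance_regular R" and d: "diam R \<ge> 1" and xy: "R x y"
  shows "card (sphere_at R 1 x \<inter> sphere_at R 1 y) = a_num R 1"
  using intersection_number_eq[OF R d d, of x y] gdist_eq_1_iff[of R x y] R xy
  by (simp add: a_num_def distance_regular_def)

lemma card_neighbours_at_two:
  assumes R: "distance_regular R" and d: "diam R \<ge> 2" and xy: "R x y"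
  shows "card (sphere_at R 1 x \<inter> sphere_at R 2 y) = b_num R 1"
  using intersection_number_eq[OF R _ d, of 1 x y] gdist_eq_1_iff[of R x y] R xy d
  by (simp add: b_num_def distance_regular_def numeral_2_eq_2)

lemma gdist_le_2:
  assumes "connected_graph R" "R x y" "R x z"
  shows "gdist R y z \<le> 2"
  using gdist_step[OF assms(1,3), of y] gdist_eq_1_iff[OF assms(1), of x y]
    gdist_commute[OF assms(1), of x y] assms(2) by simp

lemma sum_neighbours_of_edge:
  fixes f :: "'v::finite \<Rightarrow> real"
  assumes G: "connected_graph R" and xy: "R x y"
  shows "(\<Sum>z | R x z. f z) = f y + (\<Sum>z\<in>sphere_at R 1 x \<inter> sphere_at R 1 y. f z)
    + (\<Sum>z\<in>sphere_at R 1 x \<inter> sphere_at R 2 y. f z)"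
proof -
  let ?C = "sphere_at R 1 x \<inter> sphere_at R 1 y" and ?D = "sphere_at R 1 x \<inter> sphere_at R 2 y"
  have "z = y \<or> gdist R y z = 1 \<or> gdist R y z = 2" if "R x z" for z
    using gdist_le_2[OF G xy that] gdist_eq_0_iff[OF G, of y z] by auto
  then have "{z. R x z} = insert y ?C \<union> ?D"
    using xy by (auto simp: sphere_one[OF G, simplified] sphere_at_def[of R _ y])
  moreover have "y \<notin> ?C" "y \<notin> ?D" "?C \<inter> ?D = {}" by (auto simp: sphere_at_def)
  ultimately show ?thesis by (simp add: sum.union_disjoint)
qed

lemma valency_eq:
  assumes R: "distance_regular R" and d: "diam R \<ge> 2" and xy: "R x y"
  shows "real (valency R) = 1 + real (a_num R 1) + real (b_num R 1)"
  using sum_neighbours_of_edge[of R x y "\<lambda>_. 1"] card_neighbours[OF R, of x]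
    card_common_neighbours[OF R _ xy] card_neighbours_at_two[OF R d xy] R xy d
  by (simp add: distance_regular_def)

lemma ex_induced_path:
  assumes G: "connected_graph R" and d: "diam R \<ge> 2"
  shows "\<exists>x y z. R x y \<and> R y z \<and> \<not> R x z \<and> x \<noteq> z \<and> gdist R x z = 2"
proof -
  obtain x z where xz: "gdist R x z = 2" using ex_gdist[OF G d] by auto
  then have "(R ^^ 2) x z" using gdist_relpowp[OF G, of x z] by simp
  then obtain y where "R x y" "R y z" by (auto simp: numeral_2_eq_2)
  moreover have "\<not> R x z" using xz gdist_eq_1_iff[OF G, of x z] by auto
  moreover have "x \<noteq> z" using xz by auto
  ultimately show ?thesis using xz by blast
qed

lemma b_num_pos:
  assumes R: "distance_regular R" and d: "diam R \<ge> 2"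
  shows "b_num R 1 > 0"
proof -
  have G: "connected_graph R" using R by (simp add: distance_regular_def)
  obtain x y z where p: "R x y" "R y z" "gdist R x z = 2" using ex_induced_path[OF G d] by blast
  then have "x \<in> sphere_at R 1 y \<inter> sphere_at R 2 z"
    using G by (auto simp: sphere_at_def gdist_eq_1_iff gdist_commute[OF G, of z x]
        connected_graph_def[of R] dest: sympD simp del: One_nat_def)
  then show ?thesis using card_neighbours_at_two[OF R d p(2)]
    by (metis card_gt_0_iff empty_iff finite)
qed

section \<open>Primitive idempotents of a distance-regular graph\<close>

lemma primitive_idempotent_in_eigenspace:
  "adj_matrix R *v (primitive_idempotent R \<theta> *v v) = \<theta> *\<^sub>R (primitive_idempotent R \<theta> *v v)"
  using orth_proj[OF subspace_eigenspace[of "adj_matrix R" \<theta>], of v]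
  by (simp add: primitive_idempotent_apply eigenspace_def)

lemma mult_axis_nth: "(M *v axis y 1) $ x = (M :: real^'v^'v) $ x $ (y::'v::finite)"
  by (simp add: matrix_vector_mult_basis column_def)

text \<open>\<open>E\<close> is symmetric and idempotent, being an orthogonal projection.\<close>

lemma primitive_idempotent_inner:
  "(primitive_idempotent R \<theta> *v axis x 1) \<bullet> (primitive_idempotent R \<theta> *v axis y 1)
    = primitive_idempotent R \<theta> $ x $ y"
proof -
  let ?E = "primitive_idempotent R \<theta>"
  have "(axis x 1 - ?E *v axis x 1) \<bullet> (?E *v axis y 1) = 0"
    using orth_proj[OF subspace_eigenspace[of "adj_matrix R" \<theta>]]
    by (auto simp: primitive_idempotent_apply orthogonal_def)
  then show ?thesis by (simp add: inner_diff_left inner_axis' mult_axis_nth)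
qed

lemma primitive_idempotent_on_eigenvector:
  assumes "symp R" and v: "adj_matrix R *v v = \<eta> *\<^sub>R v"
  shows "primitive_idempotent R \<theta> *v v = (if \<eta> = \<theta> then v else 0)"
  unfolding primitive_idempotent_apply
proof (rule orth_proj_unique[OF subspace_eigenspace])
  show "(if \<eta> = \<theta> then v else 0) \<in> eigenspace (adj_matrix R) \<theta>"
    using v by (simp add: eigenspace_def)
  show "\<forall>u\<in>eigenspace (adj_matrix R) \<theta>. orthogonal (v - (if \<eta> = \<theta> then v else 0)) u"
  proof
    fix u assume "u \<in> eigenspace (adj_matrix R) \<theta>"
    then have "\<eta> * (v \<bullet> u) = \<theta> * (v \<bullet> u)"
      using adj_matrix_self_adjoint[OF assms(1), of v u] v by (simp add: eigenspace_def)
    then show "orthogonal (v - (if \<eta> = \<theta> then v else 0)) u" by (auto simp: orthogonal_def)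
  qed
qed

text \<open>Group the neighbours of \<open>y\<close> by their distance from \<open>x\<close>: the size of each group is an
  intersection number. In other words, the span of the distance matrices is closed under
  multiplication by the adjacency matrix.\<close>

lemma mult_adj_matrix_depends_on_distance:
  assumes R: "distance_regular R" and d: "diam R \<ge> 1" and M: "\<And>x y. M $ x $ y = m (gdist R x y)"
  shows "\<exists>m'. \<forall>x y. (M ** adj_matrix R) $ x $ y = m' (gdist R x y)"
proof -
  have G: "connected_graph R" using R by (simp add: distance_regular_def)
  have "(M ** adj_matrix R) $ x $ y
      = (\<Sum>j\<le>diam R. real (intersection_number R (gdist R x y) 1 j) * m j)" for x y
  proof -
    have "{z. R z y} = sphere_at R 1 y"
      using G by (auto simp: sphere_one[OF G, simplified] connected_graph_def dest: sympD)
    then have "(M ** adj_matrix R) $ x $ y = (\<Sum>z\<in>sphere_at R 1 y. m (gdist R x z))"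
      by (simp add: matrix_matrix_mult_def adj_matrix_def M if_distrib[of "\<lambda>c. _ * c"]
          sum.If_cases cong: if_cong)
    also have "\<dots> = (\<Sum>j\<le>diam R. \<Sum>z | z \<in> sphere_at R 1 y \<and> gdist R x z = j. m (gdist R x z))"
      by (rule sum.group[symmetric]) (auto simp: gdist_le_diam)
    also have "\<dots> = (\<Sum>j\<le>diam R. real (intersection_number R (gdist R x y) 1 j) * m j)"
    proof (rule sum.cong[OF refl])
      fix j assume j: "j \<in> {..diam R}"
      have "{z. z \<in> sphere_at R 1 y \<and> gdist R x z = j} = sphere_at R 1 y \<inter> sphere_at R j x"
        by (auto simp: sphere_at_def)
      then have "card {z. z \<in> sphere_at R 1 y \<and> gdist R x z = j}
          = intersection_number R (gdist R x y) 1 j"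
        using intersection_number_eq[OF R d, of j y x] j gdist_commute[OF G, of x y] by simp
      moreover have "(\<Sum>z | z \<in> sphere_at R 1 y \<and> gdist R x z = j. m (gdist R x z))
          = real (card {z. z \<in> sphere_at R 1 y \<and> gdist R x z = j}) * m j"
        by (subst sum.cong[OF refl, of _ _ "\<lambda>_. m j"]) auto
      ultimately show "(\<Sum>z | z \<in> sphere_at R 1 y \<and> gdist R x z = j. m (gdist R x z))
          = real (intersection_number R (gdist R x y) 1 j) * m j" by simp
    qed
    finally show ?thesis .
  qed
  then show ?thesis by (intro exI) auto
qed

text \<open>The matrix is the Lagrange polynomial that is 1 at \<open>\<theta>\<close> and 0 on \<open>F\<close>, evaluated at the
  adjacency matrix and built up one linear factor at a time.\<close>

lemma ex_separating_distance_matrix: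
  assumes R: "distance_regular R" and d: "diam R \<ge> 1" and "finite F" "\<theta> \<notin> F"
  shows "\<exists>M m. (\<forall>x y. M $ x $ y = m (gdist R x y))
    \<and> (\<forall>v. adj_matrix R *v v = \<theta> *\<^sub>R v \<longrightarrow> M *v v = v)
    \<and> (\<forall>\<eta>\<in>F. \<forall>v. adj_matrix R *v v = \<eta> *\<^sub>R v \<longrightarrow> M *v v = 0)"
  using assms(3,4)
proof (induction F)
  case empty
  have "(mat 1 :: real^'a^'a) $ x $ y = (if gdist R x y = 0 then 1 else 0)" for x y
    using R gdist_eq_0_iff[of R x y] by (simp add: mat_def distance_regular_def)
  then show ?case
    by (intro exI[of _ "mat 1"] exI[of _ "\<lambda>n. if n = 0 then 1 else 0"]) simp
next
  case (insert \<eta> F)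
  then obtain M m where m: "\<And>x y. M $ x $ y = m (gdist R x y)"
    and M: "\<And>v. adj_matrix R *v v = \<theta> *\<^sub>R v \<Longrightarrow> M *v v = v"
      "\<And>\<zeta> v. \<zeta> \<in> F \<Longrightarrow> adj_matrix R *v v = \<zeta> *\<^sub>R v \<Longrightarrow> M *v v = 0"
    by (metis insertI2)
  obtain m' where m': "\<And>x y. (M ** adj_matrix R) $ x $ y = m' (gdist R x y)"
    using mult_adj_matrix_depends_on_distance[OF R d m] by blast
  \<comment> \<open>Multiplying by \<open>A - \<eta>\<close> on the right means that an eigenvector is scaled before
    \<open>M\<close> acts on it.\<close>
  define N where "N = (1 / (\<theta> - \<eta>)) *\<^sub>R (M ** adj_matrix R - \<eta> *\<^sub>R M)"
  have N: "N *v v = ((\<zeta> - \<eta>) / (\<theta> - \<eta>)) *\<^sub>R (M *v v)" if "adj_matrix R *v v = \<zeta> *\<^sub>R v" for v \<zeta>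
    using that
    by (simp add: N_def matrix_vector_mult_diff_rdistrib scaleR_matrix_vector_assoc[symmetric]
        matrix_vector_mul_assoc[symmetric] matrix_vector_mult_scaleR scaleR_diff_left[symmetric])
  have "N $ x $ y = (m' (gdist R x y) - \<eta> * m (gdist R x y)) / (\<theta> - \<eta>)" for x y
    by (simp add: N_def m m')
  moreover have "N *v v = v" if "adj_matrix R *v v = \<theta> *\<^sub>R v" for v
    using N[OF that] M(1)[OF that] insert.prems by simp
  moreover have "N *v v = 0" if "\<zeta> \<in> insert \<eta> F" "adj_matrix R *v v = \<zeta> *\<^sub>R v" for v \<zeta>
    using N[OF that(2)] M(2)[OF _ that(2)] that(1) by auto
  ultimately show ?case
    by (intro exI[of _ N] exI[of _ "\<lambda>n. (m' n - \<eta> * m n) / (\<theta> - \<eta>)"]) blast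
qed

text \<open>The Lagrange polynomial of \<open>\<theta>\<close> on the whole spectrum agrees with \<open>E\<close> on every eigenvector,
  and the eigenvectors span the space.\<close>

lemma primitive_idempotent_depends_on_distance:
  assumes R: "distance_regular R" and d: "diam R \<ge> 1" and fin: "finite (eigenvalues (adj_matrix R))"
  shows "\<exists>e. \<forall>x y. primitive_idempotent R \<theta> $ x $ y = e (gdist R x y)"
proof -
  let ?A = "adj_matrix R"
  have sym: "symp R" using R by (simp add: distance_regular_def connected_graph_def)
  obtain M m where m: "\<And>x y. M $ x $ y = m (gdist R x y)"
    and M: "\<And>v. ?A *v v = \<theta> *\<^sub>R v \<Longrightarrow> M *v v = v"
      "\<And>\<eta> v. \<eta> \<in> eigenvalues ?A - {\<theta>} \<Longrightarrow> ?A *v v = \<eta> *\<^sub>R v \<Longrightarrow> M *v v = 0"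
    using ex_separating_distance_matrix[OF R d, of "eigenvalues ?A - {\<theta>}" \<theta>] fin
    by (metis (no_types, lifting) Diff_iff finite_Diff singletonI)
  have "M *v v = primitive_idempotent R \<theta> *v v" for v
  proof (rule linear_eq_on[OF matrix_vector_mul_linear matrix_vector_mul_linear])
    show "v \<in> span {v. \<exists>\<mu>. ?A *v v = \<mu> *\<^sub>R v}"
      using self_adjoint_eigenvectors_span[OF matrix_vector_mul_linear[of ?A]
          adj_matrix_self_adjoint[OF sym]] by simp
    fix u assume "u \<in> {v. \<exists>\<mu>. ?A *v v = \<mu> *\<^sub>R v}"
    then obtain \<mu> where u: "?A *v u = \<mu> *\<^sub>R u" by blast
    show "M *v u = primitive_idempotent R \<theta> *v u"
    proof (cases "u = 0 \<or> \<mu> = \<theta>")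
      case True
      then show ?thesis using M(1)[of u] u primitive_idempotent_on_eigenvector[OF sym u] by auto
    next
      case False
      then have "\<mu> \<in> eigenvalues ?A - {\<theta>}" using u by (auto simp: eigenvalues_def)
      then show ?thesis
        using M(2)[OF _ u] False primitive_idempotent_on_eigenvector[OF sym u] by simp
    qed
  qed
  then have "M = primitive_idempotent R \<theta>" by (simp add: matrix_eq)
  with m show ?thesis by blast
qed

lemma primitive_idempotent_diagonal_pos:
  assumes e: "\<And>x y. primitive_idempotent R \<theta> $ x $ y = e (gdist R x y)"
    and sym: "symp R" and \<theta>: "\<theta> \<in> eigenvalues (adj_matrix R)"
  shows "e 0 > 0"
proof -
  let ?E = "primitive_idempotent R \<theta>"
  have sq: "(?E *v axis x 1) \<bullet> (?E *v axis x 1) = e 0" for x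
    using primitive_idempotent_inner[of R \<theta> x x] e[of x x] by simp
  have "e 0 \<noteq> 0"
  proof
    assume "e 0 = 0"
    then have "?E *v axis x 1 = 0" for x using sq[of x] by simp
    then have "?E $ x $ y = 0" for x y by (metis mult_axis_nth zero_index)
    then have "?E *v v = 0" for v by (simp add: matrix_vector_mult_def vec_eq_iff)
    moreover obtain v where "v \<noteq> 0" "adj_matrix R *v v = \<theta> *\<^sub>R v"
      using \<theta> by (auto simp: eigenvalues_def)
    ultimately show False using primitive_idempotent_on_eigenvector[OF sym, of v \<theta> \<theta>] by simp
  qed
  moreover have "e 0 \<ge> 0" using sq by (metis inner_ge_zero)
  ultimately show ?thesis by simp
qed

text \<open>Compare the entries of \<open>A E = \<theta> E\<close> on the diagonal and at an edge.\<close>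

lemma cosine_recurrence:
  assumes R: "distance_regular R" and d: "diam R \<ge> 2" and xy: "R x y"
    and e: "\<And>x y. primitive_idempotent R \<theta> $ x $ y = e (gdist R x y)"
  shows "real (valency R) * e 1 = \<theta> * e 0"
    and "e 0 + real (a_num R 1) * e 1 + real (b_num R 1) * e 2 = \<theta> * e 1"
proof -
  let ?E = "primitive_idempotent R \<theta>"
  have G: "connected_graph R" using R by (simp add: distance_regular_def)
  have d1: "diam R \<ge> 1" using d by simp
  have row: "(\<Sum>z | R u z. e (gdist R z w)) = \<theta> * e (gdist R u w)" for u w
  proof -
    have "(adj_matrix R *v (?E *v axis w 1)) $ u = \<theta> * ?E $ u $ w"
      by (simp add: primitive_idempotent_in_eigenspace mult_axis_nth)
    then show ?thesis by (simp add: adj_matrix_mult_nth mult_axis_nth e)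
  qed
  have one: "gdist R z w = 1" "gdist R w z = 1" if "R z w" for z w
    using that gdist_eq_1_iff[OF G, of z w] gdist_commute[OF G, of z w] by simp_all
  have "(\<Sum>z | R x z. e (gdist R z x)) = (\<Sum>z | R x z. e 1)"
    by (intro sum.cong refl) (simp add: one)
  then show "real (valency R) * e 1 = \<theta> * e 0"
    using row[of x x] card_neighbours[OF R d1, of x] by simp
  have "(\<Sum>z\<in>sphere_at R 1 x \<inter> sphere_at R 1 y. e (gdist R z y))
      = (\<Sum>z\<in>sphere_at R 1 x \<inter> sphere_at R 1 y. e 1)"
    by (intro sum.cong refl) (simp add: sphere_at_def gdist_commute[OF G, of _ y])
  moreover have "(\<Sum>z\<in>sphere_at R 1 x \<inter> sphere_at R 2 y. e (gdist R z y))
      = (\<Sum>z\<in>sphere_at R 1 x \<inter> sphere_at R 2 y. e 2)"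
    by (intro sum.cong refl) (simp add: sphere_at_def gdist_commute[OF G, of _ y])
  ultimately show "e 0 + real (a_num R 1) * e 1 + real (b_num R 1) * e 2 = \<theta> * e 1"
    using row[where u = x and w = y] sum_neighbours_of_edge[OF G xy, of "\<lambda>z. e (gdist R z y)"] one(1)[OF xy]
      card_common_neighbours[OF R d1 xy] card_neighbours_at_two[OF R d xy] by simp
qed

section \<open>Tight edges\<close>

text \<open>Up to the positive factor \<open>p - q\<close>, the difference of the two sides of the inequality is the
  Gram determinant of the three vectors. It is computed through the component \<open>n\<close> of \<open>s\<close> orthogonal to \<open>u\<close> and \<open>w\<close>; by the symmetry in \<open>u\<close>
  and \<open>w\<close> the projection of \<open>s\<close> is a multiple of \<open>u + w\<close>.\<close>

lemma gram_isosceles: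
  fixes u w s :: "'a::real_inner"
  assumes uu: "u \<bullet> u = p" and ww: "w \<bullet> w = p" and uw: "u \<bullet> w = q"
    and us: "u \<bullet> s = r" and ws: "w \<bullet> s = r" and ss: "s \<bullet> s = t" and pq: "\<bar>q\<bar> < p"
  shows "2 * r\<^sup>2 \<le> t * (p + q)"
    and "(\<exists>\<alpha> \<beta> \<gamma> :: real. (\<alpha>, \<beta>, \<gamma>) \<noteq> (0, 0, 0) \<and> \<alpha> *\<^sub>R u + \<beta> *\<^sub>R w + \<gamma> *\<^sub>R s = 0)
      \<longleftrightarrow> 2 * r\<^sup>2 = t * (p + q)"
proof -
  have pos: "p + q > 0" "p - q > 0" using pq by linarith+
  have wu: "w \<bullet> u = q" and su: "s \<bullet> u = r" and sw: "s \<bullet> w = r"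
    using uw us ws by (simp_all add: inner_commute)
  define c where "c = r / (p + q)"
  have c: "c * (p + q) = r" using pos by (simp add: c_def)
  define n where "n = s - c *\<^sub>R (u + w)"
  have nu: "n \<bullet> u = 0" and nw: "n \<bullet> w = 0"
    using c by (simp_all add: n_def inner_diff_left inner_add_left uu ww uw wu su sw algebra_simps)
  have ns: "n \<bullet> s = t - 2 * c * r"
    by (simp add: n_def inner_diff_left inner_add_left ss us ws)
  have nn: "n \<bullet> n = n \<bullet> s"
    by (subst (2) n_def) (simp add: inner_diff_right inner_add_right nu nw)
  have key: "(p + q) * (n \<bullet> n) = t * (p + q) - 2 * r\<^sup>2"
  proof -
    have "(p + q) * (n \<bullet> n) = t * (p + q) - 2 * (c * (p + q)) * r"
      by (simp add: nn ns algebra_simps)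
    then show ?thesis by (simp add: c power2_eq_square)
  qed
  have "(p + q) * (n \<bullet> n) \<ge> 0" using pos by simp
  then show "2 * r\<^sup>2 \<le> t * (p + q)" using key by simp
  show "(\<exists>\<alpha> \<beta> \<gamma> :: real. (\<alpha>, \<beta>, \<gamma>) \<noteq> (0, 0, 0) \<and> \<alpha> *\<^sub>R u + \<beta> *\<^sub>R w + \<gamma> *\<^sub>R s = 0)
      \<longleftrightarrow> 2 * r\<^sup>2 = t * (p + q)"
  proof
    assume "2 * r\<^sup>2 = t * (p + q)"
    then have "n = 0" using key pos by simp
    then have "(- c) *\<^sub>R u + (- c) *\<^sub>R w + 1 *\<^sub>R s = 0" by (simp add: n_def algebra_simps)
    then show "\<exists>\<alpha> \<beta> \<gamma> :: real. (\<alpha>, \<beta>, \<gamma>) \<noteq> (0, 0, 0) \<and> \<alpha> *\<^sub>R u + \<beta> *\<^sub>R w + \<gamma> *\<^sub>R s = 0"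
      by (intro exI[of _ "- c"] exI[of _ "1::real"] conjI) simp
  next
    assume "\<exists>\<alpha> \<beta> \<gamma> :: real. (\<alpha>, \<beta>, \<gamma>) \<noteq> (0, 0, 0) \<and> \<alpha> *\<^sub>R u + \<beta> *\<^sub>R w + \<gamma> *\<^sub>R s = 0"
    then obtain \<alpha> \<beta> \<gamma> :: real where nz: "(\<alpha>, \<beta>, \<gamma>) \<noteq> (0, 0, 0)"
      and 0: "\<alpha> *\<^sub>R u + \<beta> *\<^sub>R w + \<gamma> *\<^sub>R s = 0" by blast
    have "n \<bullet> (\<alpha> *\<^sub>R u + \<beta> *\<^sub>R w + \<gamma> *\<^sub>R s) = \<gamma> * (n \<bullet> s)"
      by (simp add: inner_add_right nu nw)
    then have "\<gamma> * (n \<bullet> n) = 0" by (simp add: 0 nn)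
    moreover have "\<gamma> \<noteq> 0"
    proof
      assume \<gamma>: "\<gamma> = 0"
      have "u \<bullet> (\<alpha> *\<^sub>R u + \<beta> *\<^sub>R w + \<gamma> *\<^sub>R s) = \<alpha> * p + \<beta> * q"
        "w \<bullet> (\<alpha> *\<^sub>R u + \<beta> *\<^sub>R w + \<gamma> *\<^sub>R s) = \<alpha> * q + \<beta> * p"
        by (simp_all add: inner_add_right uu uw wu ww \<gamma>)
      then have "\<alpha> * p + \<beta> * q = 0" "\<alpha> * q + \<beta> * p = 0" by (simp_all add: 0)
      then have "(\<alpha> + \<beta>) * (p + q) = 0" "(\<alpha> - \<beta>) * (p - q) = 0" by (simp_all add: algebra_simps)
      then have "\<alpha> + \<beta> = 0" "\<alpha> - \<beta> = 0" using pos by simp_all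
      then show False using nz \<gamma> by simp
    qed
    ultimately have "n \<bullet> n = 0" by simp
    then show "2 * r\<^sup>2 = t * (p + q)" using key by simp
  qed
qed

definition far_pairs :: "('v::finite \<Rightarrow> 'v \<Rightarrow> bool) \<Rightarrow> 'v \<Rightarrow> 'v \<Rightarrow> nat" where
  "far_pairs R x y = card {p \<in> (sphere_at R 1 x \<inter> sphere_at R 1 y) \<times> (sphere_at R 1 x \<inter> sphere_at R 1 y).
     gdist R (fst p) (snd p) = 2}"

text \<open>The ordered pairs of common neighbours split by distance: the diagonal, the adjacent pairs and
  the pairs at distance 2. Counting all pairs gives the number of adjacent ones.\<close>

lemma sum_common_neighbour_pairs:
  fixes e :: "nat \<Rightarrow> real" and x y :: "'v::finite"
  assumes G: "connected_graph R"
  defines "C \<equiv> sphere_at R 1 x \<inter> sphere_at R 1 y"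
  defines "c \<equiv> real (card C)" and "g \<equiv> real (far_pairs R x y)"
  shows "(\<Sum>z\<in>C. \<Sum>w\<in>C. e (gdist R z w)) = c * e 0 + (c\<^sup>2 - c - g) * e 1 + g * e 2"
proof -
  define P where "P i = {p \<in> C \<times> C. gdist R (fst p) (snd p) = i}" for i
  have split: "(\<Sum>z\<in>C. \<Sum>w\<in>C. h (gdist R z w))
      = real (card (P 0)) * h 0 + real (card (P 1)) * h 1 + real (card (P 2)) * h 2"
    for h :: "nat \<Rightarrow> real"
  proof -
    have near: "gdist R z w \<in> {0, 1, 2}" if "z \<in> C" "w \<in> C" for z w
    proof -
      have "R x z" "R x w" using that unfolding C_def sphere_one[OF G] by auto
      then show ?thesis using gdist_le_2[OF G, of x z w] by auto
    qed
    have sub: "(\<lambda>p. gdist R (fst p) (snd p)) ` (C \<times> C) \<subseteq> {0, 1, 2}"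
      by (intro image_subsetI near) (simp_all only: mem_Times_iff)
    have "(\<Sum>z\<in>C. \<Sum>w\<in>C. h (gdist R z w)) = (\<Sum>p\<in>C \<times> C. h (gdist R (fst p) (snd p)))"
      by (simp add: sum.cartesian_product split_def)
    also have "\<dots> = (\<Sum>i\<in>{0, 1, 2}. \<Sum>p\<in>P i. h (gdist R (fst p) (snd p)))"
      unfolding P_def by (rule sum.group[OF _ _ sub, symmetric]) auto
    also have "\<dots> = (\<Sum>i\<in>{0, 1, 2}. \<Sum>p\<in>P i. h i)"
      by (intro sum.cong refl) (simp add: P_def)
    finally show ?thesis by simp
  qed
  have "P 0 = (\<lambda>z. (z, z)) ` C"
    using gdist_eq_0_iff[OF G] by (auto simp: P_def)
  then have P0: "real (card (P 0)) = c" unfolding c_def by (simp add: card_image inj_on_def)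
  have P2: "real (card (P 2)) = g" unfolding g_def far_pairs_def P_def C_def ..
  have "c\<^sup>2 = c + real (card (P 1)) + g"
    using split[of "\<lambda>_. 1"] by (simp add: P0 P2 c_def[symmetric] power2_eq_square)
  then have P1: "real (card (P 1)) = c\<^sup>2 - c - g" by simp
  show ?thesis using split[of e] unfolding P0 P1 P2 .
qed

text \<open>All three numbers \<open>e0\<close>, \<open>e1\<close>, \<open>b * e2\<close> are polynomial multiples of \<open>s = e0 / k\<close>; after this
  substitution and \<open>k = 1 + a + b\<close> the claim is a polynomial identity.\<close>

lemma gram_determinant_factor:
  fixes k a b \<theta> g e0 e1 e2 :: real
  assumes k: "k = 1 + a + b" "k \<noteq> 0" and e1: "k * e1 = \<theta> * e0"
    and e2: "e0 + a * e1 + b * e2 = \<theta> * e1"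
  shows "b * ((a * e0 + (a\<^sup>2 - a - g) * e1 + g * e2) * (e0 + e1) - 2 * (a * e1)\<^sup>2)
    = (e0 / k)\<^sup>2 * (k - \<theta>) * (a * b * (k + \<theta> * (a + 1)) - g * ((1 + \<theta>) * (k + \<theta>)))"
proof -
  define s where "s = e0 / k"
  have e0: "e0 = k * s" using k(2) by (simp add: s_def)
  have e1': "e1 = \<theta> * s" using e1 k(2) by (simp add: e0)
  have be2: "b * e2 = (\<theta>\<^sup>2 - a * \<theta> - k) * s"
    using e2 unfolding e0 e1' by (simp add: algebra_simps power2_eq_square)
  have "b * ((a * e0 + (a\<^sup>2 - a - g) * e1 + g * e2) * (e0 + e1) - 2 * (a * e1)\<^sup>2)
    = (b * (a * e0 + (a\<^sup>2 - a - g) * e1) + g * (b * e2)) * (e0 + e1) - 2 * b * (a * e1)\<^sup>2"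
    by (simp add: algebra_simps)
  also have "\<dots> = s\<^sup>2 * (k - \<theta>) * (a * b * (k + \<theta> * (a + 1)) - g * ((1 + \<theta>) * (k + \<theta>)))"
    unfolding be2 unfolding e0 e1' k(1) by (simp add: algebra_simps power2_eq_square)
  finally show ?thesis by (simp add: s_def)
qed

text \<open>The difference of the two sides is, up to a positive factor, the Gram determinant of \<open>E x\<close>, \<open>E y\<close>
  and the sum of \<open>E z\<close> over the common neighbours \<open>z\<close>. The bound \<open>\<bar>\<theta>\<bar> < k\<close> makes \<open>E x\<close> and \<open>E y\<close>
  linearly independent.\<close>

lemma tight_edge_bound:
  assumes R: "distance_regular R" and d: "diam R \<ge> 2" and fin: "finite (eigenvalues (adj_matrix R))"
    and \<theta>: "\<theta> \<in> eigenvalues (adj_matrix R)" and xy: "R x y"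
  defines "k \<equiv> real (valency R)" and "a \<equiv> real (a_num R 1)" and "b \<equiv> real (b_num R 1)"
    and "g \<equiv> real (far_pairs R x y)"
  assumes bound: "\<bar>\<theta>\<bar> < k"
  shows "g * ((1 + \<theta>) * (k + \<theta>)) \<le> a * b * (k + \<theta> * (a + 1))"
    and "tight_edge R \<theta> x y \<longleftrightarrow> g * ((1 + \<theta>) * (k + \<theta>)) = a * b * (k + \<theta> * (a + 1))"
proof -
  have G: "connected_graph R" and sym: "symp R"
    using R by (simp_all add: distance_regular_def connected_graph_def)
  have d1: "diam R \<ge> 1" using d by simp
  have yx: "R y x" using sym xy by (rule sympD)
  obtain e where e: "\<And>x y. primitive_idempotent R \<theta> $ x $ y = e (gdist R x y)"
    using primitive_idempotent_depends_on_distance[OF R d1 fin] by blast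
  have kpos: "k > 0" using bound by linarith
  have bpos: "b > 0" using b_num_pos[OF R d] by (simp add: b_def)
  have e0: "e 0 > 0" using primitive_idempotent_diagonal_pos[OF e sym \<theta>] .
  have e1: "k * e 1 = \<theta> * e 0" and e2: "e 0 + a * e 1 + b * e 2 = \<theta> * e 1"
    using cosine_recurrence[OF R d xy e] unfolding k_def a_def b_def by simp_all
  have kab: "k = 1 + a + b" using valency_eq[OF R d xy] unfolding k_def a_def b_def .
  have e1_lt: "\<bar>e 1\<bar> < e 0"
  proof -
    have "k * \<bar>e 1\<bar> = \<bar>\<theta>\<bar> * e 0" using e1 e0 kpos by (metis abs_mult abs_of_pos)
    also have "\<dots> < k * e 0" using bound e0 by simp
    finally show ?thesis using kpos by simp
  qed
  define C where "C = sphere_at R 1 x \<inter> sphere_at R 1 y"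
  have cardC: "real (card C) = a"
    using card_common_neighbours[OF R d1 xy] by (simp add: C_def a_def)
  define E where "E z = primitive_idempotent R \<theta> *v axis z 1" for z
  have E: "E z \<bullet> E w = e (gdist R z w)" for z w
    unfolding E_def by (simp only: primitive_idempotent_inner e)
  define s where "s = (\<Sum>z\<in>C. E z)"
  have one: "gdist R x y = 1" using xy gdist_eq_1_iff[OF G] by blast
  have xs: "E x \<bullet> s = a * e 1"
  proof -
    have "E x \<bullet> s = (\<Sum>z\<in>C. e 1)"
      unfolding s_def inner_sum_right by (intro sum.cong refl) (simp add: E C_def sphere_at_def)
    then show ?thesis by (simp add: cardC)
  qed
  have ys: "E y \<bullet> s = a * e 1"
  proof -
    have "E y \<bullet> s = (\<Sum>z\<in>C. e 1)"
      unfolding s_def inner_sum_right by (intro sum.cong refl) (simp add: E C_def sphere_at_def)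
    then show ?thesis by (simp add: cardC)
  qed
  define t where "t = a * e 0 + (a\<^sup>2 - a - g) * e 1 + g * e 2"
  have ss: "s \<bullet> s = t"
  proof -
    have "s \<bullet> s = (\<Sum>z\<in>C. \<Sum>w\<in>C. e (gdist R z w))"
      unfolding s_def by (simp only: inner_sum_left inner_sum_right E)
        (rule sum.swap)
    then show ?thesis
      using sum_common_neighbour_pairs[OF G, of e x y] cardC unfolding t_def g_def C_def by simp
  qed
  define D where "D = a * b * (k + \<theta> * (a + 1)) - g * ((1 + \<theta>) * (k + \<theta>))"
  \<comment> \<open>This factor relates \<open>D\<close> to the difference of the two sides of the isosceles Gram bound; it is
    positive because \<open>\<theta> < k\<close>.\<close>
  define m where "m = (e 0 / k)\<^sup>2 * (k - \<theta>)"
  have m: "m > 0" using e0 kpos bound by (simp add: m_def)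
  have D: "b * (t * (e 0 + e 1) - 2 * (a * e 1)\<^sup>2) = m * D"
    unfolding t_def D_def m_def using gram_determinant_factor[OF kab _ e1 e2] kpos by simp
  have E00: "E x \<bullet> E x = e 0" "E y \<bullet> E y = e 0" "E x \<bullet> E y = e 1"
    by (simp_all only: E gdist_self one)
  note gram = gram_isosceles[OF E00 xs ys ss e1_lt]
  have "m * D \<ge> 0" unfolding D[symmetric] using gram(1) bpos by simp
  then have "D \<ge> 0" using m by (simp add: zero_le_mult_iff)
  then show "g * ((1 + \<theta>) * (k + \<theta>)) \<le> a * b * (k + \<theta> * (a + 1))" by (simp only: D_def)
  have "tight_edge R \<theta> x y \<longleftrightarrow> 2 * (a * e 1)\<^sup>2 = t * (e 0 + e 1)"
    unfolding gram(2)[symmetric] tight_edge_def Let_def E_def s_def C_def ..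
  also have "\<dots> \<longleftrightarrow> b * (t * (e 0 + e 1) - 2 * (a * e 1)\<^sup>2) = 0" using bpos by auto
  also have "\<dots> \<longleftrightarrow> D = 0" unfolding D using m by simp
  finally show "tight_edge R \<theta> x y \<longleftrightarrow> g * ((1 + \<theta>) * (k + \<theta>)) = a * b * (k + \<theta> * (a + 1))"
    by (auto simp only: D_def)
qed

text \<open>The cross-multiplied difference is antisymmetric in \<open>s\<close> and \<open>t\<close>, hence divisible by \<open>t - s\<close>;
  the cofactor is the cleared product form.\<close>

lemma tightness_condition_product_form:
  fixes k a b s t :: real
  assumes k: "k = 1 + a + b" and a: "a + 1 \<noteq> 0" and st: "s \<noteq> t"
    and nz: "k + s \<noteq> 0" "1 + s \<noteq> 0" "k + t \<noteq> 0" "1 + t \<noteq> 0"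
  shows "(k + s * (a + 1)) / ((k + s) * (1 + s)) = (k + t * (a + 1)) / ((k + t) * (1 + t))
    \<longleftrightarrow> (t + k / (a + 1)) * (s + k / (a + 1)) = - (k * a * b / (a + 1)\<^sup>2)"
proof -
  define P where "P = (t * (a + 1) + k) * (s * (a + 1) + k) + k * a * b"
  have "(k + s * (a + 1)) / ((k + s) * (1 + s)) = (k + t * (a + 1)) / ((k + t) * (1 + t))
    \<longleftrightarrow> (k + s * (a + 1)) * ((k + t) * (1 + t)) - (k + t * (a + 1)) * ((k + s) * (1 + s)) = 0"
    using nz by (simp add: frac_eq_eq)
  also have "\<dots> \<longleftrightarrow> (a + 1) * ((k + s * (a + 1)) * ((k + t) * (1 + t))
      - (k + t * (a + 1)) * ((k + s) * (1 + s))) = 0"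
    using a by simp
  also have "(a + 1) * ((k + s * (a + 1)) * ((k + t) * (1 + t))
      - (k + t * (a + 1)) * ((k + s) * (1 + s))) = (t - s) * P"
    unfolding P_def k by (simp add: algebra_simps)
  also have "(t - s) * P = 0 \<longleftrightarrow> P = 0" using st by simp
  also have "P = 0 \<longleftrightarrow> P / (a + 1)\<^sup>2 = 0" using a by simp
  also have "P / (a + 1)\<^sup>2 = (t + k / (a + 1)) * (s + k / (a + 1)) + k * a * b / (a + 1)\<^sup>2"
  proof -
    have clear: "(T * u * (S * u) + c) / u\<^sup>2 = T * S + c / u\<^sup>2" if "u \<noteq> 0" for T S u c :: real
      using that by (simp add: add_divide_distrib power2_eq_square)
    have "t * (a + 1) + k = (t + k / (a + 1)) * (a + 1)" "s * (a + 1) + k = (s + k / (a + 1)) * (a + 1)"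
      using a by (simp_all add: distrib_right[of _ _ "a + 1"])
    then show ?thesis unfolding P_def by (simp only: clear[OF a])
  qed
  finally show ?thesis by (simp add: eq_neg_iff_add_eq_0)
qed

section \<open>The characterisation of tight graphs\<close>

theorem corollary6p3:
  fixes R :: "'v::finite \<Rightarrow> 'v \<Rightarrow> bool"
    and d :: nat and \<theta> :: "nat \<Rightarrow> real" and k a1 b1 :: real
  assumes "distance_regular R"
    and "\<not> bipartite R"
    and "d = diam R" and "d \<ge> 3"
    and "eigenvalues (adj_matrix R) = \<theta> ` {0..d}"
    and "\<forall>i j. i < j \<and> j \<le> d \<longrightarrow> \<theta> i > \<theta> j"
    and "k = real (valency R)" and "a1 = real (a_num R 1)" and "b1 = real (b_num R 1)"
  shows
    "let stmt_i = ((k + \<theta> d * (a1 + 1)) / ((k + \<theta> d) * (1 + \<theta> d))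
                   = (k + \<theta> 1 * (a1 + 1)) / ((k + \<theta> 1) * (1 + \<theta> 1)));
         stmt_ii = ((\<theta> 1 + k / (a1 + 1)) * (\<theta> d + k / (a1 + 1)) = - (k * a1 * b1 / (a1 + 1)\<^sup>2));
         stmt_iii = (a1 \<noteq> 0 \<and>
           (\<forall>x y. R x y \<longrightarrow> tight_edge R (\<theta> 1) x y \<and> tight_edge R (\<theta> d) x y));
         stmt_iv = (a1 \<noteq> 0 \<and>
           (\<exists>x y. R x y \<and> tight_edge R (\<theta> 1) x y \<and> tight_edge R (\<theta> d) x y))
     in (stmt_i \<longleftrightarrow> stmt_ii) \<and> (stmt_ii \<longleftrightarrow> stmt_iii) \<and> (stmt_iii \<longleftrightarrow> stmt_iv)"
proof -
  note DR = assms(1) and eig = assms(5) and decr = assms(6)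
  have G: "connected_graph R" and sym: "symp R" and irr: "irreflp R"
    using DR by (simp_all add: distance_regular_def connected_graph_def)
  have d: "diam R \<ge> 2" "diam R \<ge> 1" using assms(3,4) by simp_all
  have d3: "1 < d" "1 \<le> d" using assms(4) by simp_all
  have reg: "real (card {z. R x z}) = k" for x
    using card_neighbours[OF DR d(2), of x] assms(7) by simp
  have fin: "finite (eigenvalues (adj_matrix R))" unfolding eig by simp
  obtain p q r where path: "R p q" "R q r" "\<not> R p r" "p \<noteq> r"
    using ex_induced_path[OF G d(1)] by blast
  have kab: "k = 1 + a1 + b1"
    using valency_eq[OF DR d(1) path(1)] assms(7-9) by simp
  have a1: "a1 \<ge> 0" and b1: "b1 > 0" using b_num_pos[OF DR d(1)] assms(8,9) by simp_all
  have mem: "\<theta> i \<in> eigenvalues (adj_matrix R)" if "i \<le> d" for i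
    unfolding eig using that by (intro imageI) simp
  have le_k: "\<mu> \<le> k" "- k \<le> \<mu>" if \<mu>: "\<mu> \<in> eigenvalues (adj_matrix R)" for \<mu>
  proof -
    obtain v where v: "v \<noteq> 0" "adj_matrix R *v v = \<mu> *\<^sub>R v"
      using \<mu> by (auto simp: eigenvalues_def)
    show "\<mu> \<le> k" using eigenvalue_bound(1)[OF sym reg _ v, of "-1"] by simp
    show "- k \<le> \<mu>" using eigenvalue_bound(1)[OF sym reg _ v, of 1] by simp
  qed
  have order: "\<theta> j < \<theta> i" if "i < j" "j \<le> d" for i j using decr that by blast
  have neg_k: "\<theta> d > - k"
  proof -
    have "\<theta> d \<noteq> - k"
      using minus_valency_eigenvalue_imp_bipartite[OF G reg] mem[of d] assms(2) by auto
    then show ?thesis using le_k(2)[OF mem[of d]] by simp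
  qed
  have lt: "\<theta> d < \<theta> 1" using order[of 1 d] d3 by simp
  have "\<theta> 1 < \<theta> 0" using order[of 0 1] d3 by simp
  then have \<theta>1_k: "\<theta> 1 < k" using le_k(1)[OF mem[of 0]] by simp
  have \<theta>d: "\<theta> d < - 1"
  proof -
    obtain \<mu> where "\<mu> \<in> eigenvalues (adj_matrix R)" "\<mu> < - 1"
      using eigenvalue_lt_minus_one[OF sym path irr] by blast
    then obtain i where i: "i \<le> d" "\<theta> i < - 1" unfolding eig by auto
    then show ?thesis using order[of i d] by (cases "i = d") auto
  qed
  \<comment> \<open>The eigenvalue \<open>\<theta> 0\<close> is \<open>k\<close>, so any eigenvalue other than \<open>k\<close> is at most \<open>\<theta> 1\<close>.\<close>
  have \<theta>1: "\<theta> 1 \<ge> 0"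
  proof -
    obtain \<mu> where \<mu>: "\<mu> \<in> eigenvalues (adj_matrix R)" "\<mu> \<noteq> k" "\<mu> \<ge> 0"
      using nontrivial_eigenvalue_nonneg[OF G reg path(4,3)] by blast
    then obtain i where i: "i \<le> d" "\<mu> = \<theta> i" unfolding eig by auto
    have "k \<in> eigenvalues (adj_matrix R)" by (rule valency_eigenvalue[OF reg])
    then obtain j where j: "j \<le> d" "k = \<theta> j" unfolding eig by auto
    have "j = 0"
    proof (rule ccontr)
      assume "j \<noteq> 0"
      then show False using order[of 0 j] j le_k(1)[OF mem[of 0]] by simp
    qed
    then have "i \<noteq> 0" using i j \<mu>(2) by metis
    then show ?thesis using order[of 1 i] i \<mu>(3) by (cases "i = 1") auto
  qed
  have abs: "\<bar>\<theta> d\<bar> < k" "\<bar>\<theta> 1\<bar> < k" using neg_k \<theta>d \<theta>1 \<theta>1_k lt by linarith+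
  \<comment> \<open>\<open>N\<close> and \<open>den\<close> are numerator and denominator of the two sides of (i), and \<open>QQ\<close> is (i) itself.\<close>
  define den where "den t = (k + t) * (1 + t)" for t
  define N where "N t = k + t * (a1 + 1)" for t
  define QQ where "QQ \<longleftrightarrow> N (\<theta> d) / den (\<theta> d) = N (\<theta> 1) / den (\<theta> 1)"
  have den1: "den (\<theta> 1) > 0" using abs(2) \<theta>1 unfolding den_def by (intro mult_pos_pos) auto
  have dend: "den (\<theta> d) < 0" using neg_k \<theta>d unfolding den_def by (intro mult_pos_neg) auto
  have QQ_ii: "QQ \<longleftrightarrow> (\<theta> 1 + k / (a1 + 1)) * (\<theta> d + k / (a1 + 1)) = - (k * a1 * b1 / (a1 + 1)\<^sup>2)"
    unfolding QQ_def N_def den_def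
    by (rule tightness_condition_product_form[OF kab]) (use a1 lt neg_k \<theta>d \<theta>1 \<theta>1_k in auto)
  have bound: "real (far_pairs R x y) * den (\<theta> n) \<le> a1 * b1 * N (\<theta> n)"
    and tight: "tight_edge R (\<theta> n) x y \<longleftrightarrow> real (far_pairs R x y) * den (\<theta> n) = a1 * b1 * N (\<theta> n)"
    if "R x y" "n = 1 \<or> n = d" for x y n
    using tight_edge_bound[OF DR d(1) fin mem[of n] that(1)] that(2) abs d3
    unfolding den_def N_def assms(7-9) by (auto simp: mult.commute)
  have a1_nz: "a1 \<noteq> 0" if QQ
  proof
    assume "a1 = 0"
    then have "N t / den t = 1 / (1 + t)" if "k + t \<noteq> 0" for t
      using that by (simp add: N_def den_def)
    moreover have "k + \<theta> d \<noteq> 0" "k + \<theta> 1 \<noteq> 0" using abs by linarith+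
    ultimately have "1 / (1 + \<theta> d) = 1 / (1 + \<theta> 1)"
      using that unfolding QQ_def by metis
    then show False using lt \<theta>d \<theta>1 by (simp add: divide_simps)
  qed
  have QQ_tight: "tight_edge R (\<theta> 1) x y \<and> tight_edge R (\<theta> d) x y" if QQ "R x y" for x y
  proof -
    define f where "f = real (far_pairs R x y)"
    define c where "c = a1 * b1 * (N (\<theta> 1) / den (\<theta> 1))"
    \<comment> \<open>Both bounds on \<open>f\<close> are the same number \<open>c\<close>: an upper one since \<open>den (\<theta> 1) > 0\<close>, a lower one
      since \<open>den (\<theta> d) < 0\<close>.\<close>
    have c: "a1 * b1 * N (\<theta> 1) = c * den (\<theta> 1)" "a1 * b1 * N (\<theta> d) = c * den (\<theta> d)"
      using that(1) den1 dend unfolding c_def QQ_def by (simp, metis less_irrefl nonzero_eq_divide_eq mult.assoc)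
    have "f * den (\<theta> 1) \<le> c * den (\<theta> 1)" "f * den (\<theta> d) \<le> c * den (\<theta> d)"
      using bound[OF that(2), of 1] bound[OF that(2), of d] unfolding f_def c by simp_all
    then have "f \<le> c" "c \<le> f" using den1 dend by simp_all
    then have "f = c" by simp
    then show ?thesis
      using tight[OF that(2), of 1] tight[OF that(2), of d] unfolding f_def c by simp
  qed
  have tight_QQ: QQ if "a1 \<noteq> 0" "R x y" "tight_edge R (\<theta> 1) x y" "tight_edge R (\<theta> d) x y" for x y
  proof -
    define f where "f = real (far_pairs R x y)"
    have ab: "a1 * b1 \<noteq> 0" using that(1) b1 by simp
    have "f * den (\<theta> 1) = a1 * b1 * N (\<theta> 1)" "f * den (\<theta> d) = a1 * b1 * N (\<theta> d)"
      using tight[OF that(2), of 1] tight[OF that(2), of d] that(3,4) unfolding f_def by simp_all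
    then have "N (\<theta> 1) / den (\<theta> 1) = f / (a1 * b1)" "N (\<theta> d) / den (\<theta> d) = f / (a1 * b1)"
      using ab den1 dend by (simp_all add: frac_eq_eq mult.commute)
    then show ?thesis unfolding QQ_def by simp
  qed
  have "QQ \<longleftrightarrow> a1 \<noteq> 0 \<and> (\<forall>x y. R x y \<longrightarrow> tight_edge R (\<theta> 1) x y \<and> tight_edge R (\<theta> d) x y)"
    using a1_nz QQ_tight tight_QQ path(1) by blast
  moreover have "QQ \<longleftrightarrow> a1 \<noteq> 0 \<and> (\<exists>x y. R x y \<and> tight_edge R (\<theta> 1) x y \<and> tight_edge R (\<theta> d) x y)"
    using a1_nz QQ_tight tight_QQ path(1) by blast
  ultimately show ?thesis
    unfolding Let_def using QQ_ii unfolding QQ_def N_def den_def by argo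
qed

end
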